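(* Let $q\in\mathbb{C}$ with $0<|q|<1$, and let $F_1$ and $F_2$ be the functions of nonzero complex variables $x,y,u,v$ defined in the context. Then for all $x,y,u,v\in\mathbb{C}\setminus\{0\}$ the following two identities hold: \[ F_1(x,y,u,v;q)+F_1(-x,y,-u,v;q)-xy\,F_1(qx,qy,u,v;q)-xy\,F_1(-qx,qy,-u,v;q)=F_2(x,y,u,v;q), \] \[ F_2(x,y,u,v;q)-u y^{-1}\,F_2(x,u,y,v;q)=2F_1(x,y,u,v;q). \] Because of these identities, the formulas $F_1(x,y,u,v;q)=0$ (for all $x,y,u,v\in\mathbb{C}\setminus\{0\}$) and $F_2(x,y,u,v;q)=0$ (for all $x,y,u,v\in\mathbb{C}\setminus\{0\}$) are equivalent to each other.
   Context: For a nome $p\in\mathbb{C}$ with $0<|p|<1$ and $w\in\mathbb{C}\setminus\{0\}$, the theta function is \[ \theta(w;p):=\prod_{j=0}^\infty(1-p^jw)(1-p^{j+1}/w), \] and for nonzero $w_1,\ldots,w_k$ one writes $\theta(w_1,\ldots,w_k;p):=\theta(w_1;p)\cdots\theta(w_k;p)$. Below, the nome used is $p=q^2$, where $0<|q|<1$. For $x,y,u,v\in\mathbb{C}\setminus\{0\}$ define \[ F_1(x,y,u,v;q):=\theta(xy,x/y,uv,u/v;q^2)-\theta(xv,x/v,uy,u/y;q^2)-u y^{-1}\,\theta(yv,y/v,xu,x/u;q^2) \] and \begin{align*} F_2(x,y,u,v;q):={}&2\,\theta(xy,x/y,uv,u/v;q^2)-\theta(xv,x/v,uy,u/y;q^2)-\theta(-xv,-x/v,-uy,-u/y;q^2)\\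 &-q^{-1}xu\big(\theta(qxv,qx/v,quy,qu/y;q^2)-\theta(-qxv,-qx/v,-quy,-qu/y;q^2)\big). \end{align*} *)

theory Defs
  imports "HOL-Analysis.Analysis"
begin

text \<open>
  For \<open>0 < norm p < 1\<close> and \<open>w \<noteq> 0\<close> the infinite product converges (absolutely);
  \<^const>\<open>prodinf\<close> is \<open>0\<close> when some (necessarily finitely many) factors vanish, i.e. it agrees with the
  limit of the partial products.
\<close>

definition theta :: "complex \<Rightarrow> complex \<Rightarrow> complex" where
  "theta w p = (\<Prod>j. (1 - p ^ j * w) * (1 - p ^ (j + 1) / w))"

definition thetas :: "complex list \<Rightarrow> complex \<Rightarrow> complex" where
  "thetas ws p = (\<Prod>w\<leftarrow>ws. theta w p)"

definition F1 :: "complex \<Rightarrow> complex \<Rightarrow> complex \<Rightarrow> complex \<Rightarrow> complex \<Rightarrow> complex" where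
  "F1 x y u v q =
     thetas [x * y, x/y, u * v, u/v] (q^2)
     - thetas [x * v, x/v, u * y, u/y] (q^2)
     - u * inverse y * thetas [y * v, y/v, x * u, x/u] (q^2)"

definition F2 :: "complex \<Rightarrow> complex \<Rightarrow> complex \<Rightarrow> complex \<Rightarrow> complex \<Rightarrow> complex" where
  "F2 x y u v q =
     2 * thetas [x * y, x/y, u * v, u/v] (q^2)
     - thetas [x * v, x/v, u * y, u/y] (q^2)
     - thetas [- (x * v), - (x/v), - (u * y), - (u/y)] (q^2)
     - inverse q * x * u *
         (thetas [q * x * v, q * x/v, q * u * y, q * u/y] (q^2)
          - thetas [- (q * x * v), - (q * x/v), - (q * u * y), - (q * u/y)] (q^2))"

end

theory Submission
  imports Defs
begin

text \<open>
  Both identities are formal consequences of the inversion \<open>\<theta>(1/w;p) = -\<theta>(w;p)/w\<close> and the reflection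
  \<open>\<theta>(p/w;p) = \<theta>(w;p)\<close>. In the first, these turn the terms of the shifted functions
  \<open>F\<^sub>1(\<plusminus>qx,qy,\<plusminus>u,v)\<close> into terms of \<open>F\<^sub>2\<close>, while the terms with prefactor \<open>u/y\<close> cancel in the pairs
  \<open>(x,u), (-x,-u)\<close>. In the second, exchanging \<open>y\<close> and \<open>u\<close> only inverts the argument \<open>u/y\<close>.
\<close>

lemma convergent_prod_one_minus_power:
  fixes a p :: complex
  assumes "norm p < 1"
  shows "convergent_prod (\<lambda>j. 1 - p ^ j * a)"
proof -
  have "summable (\<lambda>j. norm p ^ j * norm a)"
    using assms by (intro summable_mult2 summable_geometric) simp
  then have "abs_convergent_prod (\<lambda>j. 1 - p ^ j * a)"
    by (intro summable_imp_abs_convergent_prod) (simp add: norm_mult norm_power)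
  then show ?thesis
    by (rule abs_convergent_prod_imp_convergent_prod)
qed

definition q_pochhammer_inf :: "complex \<Rightarrow> complex \<Rightarrow> complex" where
  "q_pochhammer_inf a p = (\<Prod>j. 1 - p ^ j * a)"

lemma q_pochhammer_inf_rec:
  assumes "norm p < 1"
  shows "q_pochhammer_inf a p = (1 - a) * q_pochhammer_inf (p * a) p"
proof -
  have "(\<lambda>j. 1 - p ^ j * (p * a)) has_prod q_pochhammer_inf (p * a) p"
    unfolding q_pochhammer_inf_def
    by (intro convergent_prod_has_prod convergent_prod_one_minus_power assms)
  \<comment> \<open>Passing from \<open>a\<close> to \<open>p * a\<close> shifts the index by one.
    Restoring the factor at \<open>j = 0\<close> is valid even when that factor is zero.\<close>
  then have "(\<lambda>j. 1 - p ^ Suc j * a) has_prod q_pochhammer_inf (p * a) p"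
    by (simp add: mult_ac)
  from has_prod_unique[OF has_prod_Suc_imp[OF this]] show ?thesis
    by (simp add: q_pochhammer_inf_def mult_ac)
qed

text \<open>Both one-sided products converge, so the product of paired factors splits. Reflection
  then merely exchanges the two halves.\<close>

lemma theta_eq_q_pochhammer_inf:
  assumes "norm p < 1"
  shows "theta w p = q_pochhammer_inf w p * q_pochhammer_inf (p / w) p"
  using prodinf_mult[OF convergent_prod_one_minus_power[OF assms, of w]
      convergent_prod_one_minus_power[OF assms, of "p / w"]]
  by (simp add: theta_def q_pochhammer_inf_def mult_ac)

text \<open>Peeling off one linear factor leaves the same two products for \<open>w\<close> and
  \<open>1 / w\<close>, so everything reduces to 1 - 1/w = -(1 - w)/w.\<close>

lemma theta_inverse:
  assumes "norm p < 1" "w \<noteq> 0"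
  shows "theta (1 / w) p = - theta w p / w"
proof -
  have "theta (1 / w) p = (1 - 1 / w) * (q_pochhammer_inf (p / w) p * q_pochhammer_inf (p * w) p)"
    using assms(1) q_pochhammer_inf_rec[of p "1 / w"] by (simp add: theta_eq_q_pochhammer_inf)
  moreover have "theta w p = (1 - w) * (q_pochhammer_inf (p / w) p * q_pochhammer_inf (p * w) p)"
    using assms(1) q_pochhammer_inf_rec[of p w] by (simp add: theta_eq_q_pochhammer_inf)
  ultimately show ?thesis
    using assms(2) by (simp add: divide_simps) (simp add: algebra_simps)
qed

lemma theta_reflect:
  assumes "norm p < 1" "p \<noteq> 0"
  shows "theta (p / w) p = theta w p"
  using assms by (simp add: theta_eq_q_pochhammer_inf mult.commute)

lemma theta_shift:
  assumes "norm p < 1" "p \<noteq> 0" "w \<noteq> 0"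
  shows "theta (p * w) p = - theta w p / w"
  using theta_reflect[of p "1 / w"] theta_inverse[of p w] assms by simp

lemma theta_swap:
  assumes "norm p < 1" "a \<noteq> 0" "b \<noteq> 0"
  shows "theta (a / b) p = - (a / b) * theta (b / a) p"
  using theta_inverse[of p "b / a"] assms by simp

text \<open>The two arguments multiply to the nome \<open>q\<^sup>2\<close>, so reflection exchanges
  them; unlike in \<open>theta_swap\<close>, no prefactor appears.\<close>

lemma theta_half_period_swap:
  assumes "norm (q\<^sup>2) < 1" "q \<noteq> 0" "a \<noteq> 0"
  shows "theta (q * a / b) (q\<^sup>2) = theta (q * b / a) (q\<^sup>2)"
  using theta_reflect[of "q\<^sup>2" "q * b / a"] assms by (simp add: power2_eq_square)

lemma F1_add_F1_minus:
  "F1 x y u v q + F1 (- x) y (- u) v q =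
     thetas [x * y, x / y, u * v, u / v] (q\<^sup>2)
     + thetas [- (x * y), - (x / y), - (u * v), - (u / v)] (q\<^sup>2)
     - thetas [x * v, x / v, u * y, u / y] (q\<^sup>2)
     - thetas [- (x * v), - (x / v), - (u * y), - (u / y)] (q\<^sup>2)"
  by (simp add: F1_def thetas_def)

lemma F1_half_period_shift:
  assumes "norm (q\<^sup>2) < 1" "q \<noteq> 0" "x \<noteq> 0" "y \<noteq> 0" "u \<noteq> 0"
  shows "x * y * F1 (q * x) (q * y) u v q =
     - thetas [x * y, x / y, u * v, u / v] (q\<^sup>2)
     + inverse q * x * u * thetas [q * x * v, q * x / v, q * u * y, q * u / y] (q\<^sup>2)
     - inverse q * x * u * thetas [q * y * v, q * y / v, q * x * u, q * x / u] (q\<^sup>2)"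
proof -
  have xy: "theta (q * x * (q * y)) (q\<^sup>2) = - theta (x * y) (q\<^sup>2) / (x * y)"
    using theta_shift[of "q\<^sup>2" "x * y"] assms by (simp add: power2_eq_square mult_ac)
  \<comment> \<open>Inversion followed by the half-period swap. The prefactor, multiplied by
    \<open>x * y\<close>, becomes the coefficient \<open>inverse q * x * u\<close> of
    \<open>F2\<close>, up to sign.\<close>
  have uy: "theta (u / (q * y)) (q\<^sup>2) = - (u / (q * y)) * theta (q * u / y) (q\<^sup>2)"
    using theta_swap[of "q\<^sup>2" u "q * y"] theta_half_period_swap[of q y u] assms by simp
  show ?thesis
    using assms unfolding F1_def thetas_def
    by (simp add: xy uy) (simp add: field_simps)
qed

lemma F1_combination_eq_F2:
  assumes "norm (q\<^sup>2) < 1" "q \<noteq> 0" "x \<noteq> 0" "y \<noteq> 0" "u \<noteq> 0"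
  shows "F1 x y u v q + F1 (- x) y (- u) v q
           - x * y * F1 (q * x) (q * y) u v q - x * y * F1 (- (q * x)) (q * y) (- u) v q
         = F2 x y u v q"
proof -
  \<comment> \<open>Replacing \<open>x\<close>, \<open>u\<close> by their negatives keeps
    \<open>x * u\<close> but flips \<open>x * y\<close>. Hence the terms in \<open>q * y * v\<close>
    get opposite signs in the two shifted functions and cancel, and the first term here cancels its
    counterpart in \<open>F1_add_F1_minus\<close>.\<close>
  have minus: "x * y * F1 (- (q * x)) (q * y) (- u) v q =
     thetas [- (x * y), - (x / y), - (u * v), - (u / v)] (q\<^sup>2)
     + inverse q * x * u *
       (thetas [q * y * v, q * y / v, q * x * u, q * x / u] (q\<^sup>2)
        - thetas [- (q * x * v), - (q * x / v), - (q * u * y), - (q * u / y)] (q\<^sup>2))"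
    using F1_half_period_shift[of q "- x" y "- u" v] assms
    by (simp add: thetas_def algebra_simps)
  show ?thesis
    unfolding F1_add_F1_minus F1_half_period_shift[OF assms] minus F2_def
    by (simp only: right_diff_distrib) simp
qed

text \<open>After exchanging \<open>y\<close> and \<open>u\<close> and multiplying by u/y, the term
  with \<open>u / y\<close> reappears with the opposite sign, so subtraction doubles it. The terms
  with \<open>- (u / y)\<close> and with half-period arguments reappear unchanged and
  cancel.\<close>

lemma F2_combination_eq_F1:
  assumes "norm (q\<^sup>2) < 1" "q \<noteq> 0" "y \<noteq> 0" "u \<noteq> 0"
  shows "F2 x y u v q - u * inverse y * F2 x u y v q = 2 * F1 x y u v q"
proof -
  have plain: "theta (y / u) (q\<^sup>2) = - (y / u) * theta (u / y) (q\<^sup>2)"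
    using theta_swap[of "q\<^sup>2" y u] assms by simp
  have neg: "theta (- (y / u)) (q\<^sup>2) = (y / u) * theta (- (u / y)) (q\<^sup>2)"
    using theta_swap[of "q\<^sup>2" "- y" u] assms by simp
  have half: "theta (q * y / u) (q\<^sup>2) = theta (q * u / y) (q\<^sup>2)"
    using theta_half_period_swap[of q y u] assms by simp
  have half_neg: "theta (- (q * y / u)) (q\<^sup>2) = theta (- (q * u / y)) (q\<^sup>2)"
    using theta_half_period_swap[of q "- y" u] assms by simp
  show ?thesis
    using assms unfolding F1_def F2_def thetas_def
    by (simp add: plain neg half half_neg) (simp add: field_simps)
qed

theorem theorem5p1:
  fixes q :: complex
  assumes "0 < norm q" and "norm q < 1"
  shows
    "(\<forall>x y u v :: complex. x \<noteq> 0 \<longrightarrow> y \<noteq> 0 \<longrightarrow> u \<noteq> 0 \<longrightarrow> v \<noteq> 0 \<longrightarrow>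
        F1 x y u v q + F1 (-x) y (-u) v q
          - x * y * F1 (q*x) (q*y) u v q - x * y * F1 (-(q*x)) (q*y) (-u) v q
        = F2 x y u v q) \<and>
     (\<forall>x y u v :: complex. x \<noteq> 0 \<longrightarrow> y \<noteq> 0 \<longrightarrow> u \<noteq> 0 \<longrightarrow> v \<noteq> 0 \<longrightarrow>
        F2 x y u v q - u * inverse y * F2 x u y v q = 2 * F1 x y u v q) \<and>
     ((\<forall>x y u v :: complex. x \<noteq> 0 \<longrightarrow> y \<noteq> 0 \<longrightarrow> u \<noteq> 0 \<longrightarrow> v \<noteq> 0 \<longrightarrow> F1 x y u v q = 0)
      \<longleftrightarrow>
      (\<forall>x y u v :: complex. x \<noteq> 0 \<longrightarrow> y \<noteq> 0 \<longrightarrow> u \<noteq> 0 \<longrightarrow> v \<noteq> 0 \<longrightarrow> F2 x y u v q = 0))"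
proof -
  have q: "norm (q\<^sup>2) < 1" "q \<noteq> 0"
    using assms by (auto simp: norm_power power_less_one_iff)
  note F2_from_F1 = F1_combination_eq_F2[OF q, symmetric]
    and F1_from_F2 = F2_combination_eq_F1[OF q, symmetric]
  have "F2 x y u v q = 0"
    if F1: "\<forall>x y u v. x \<noteq> 0 \<longrightarrow> y \<noteq> 0 \<longrightarrow> u \<noteq> 0 \<longrightarrow> v \<noteq> 0 \<longrightarrow> F1 x y u v q = 0"
      and "x \<noteq> 0" "y \<noteq> 0" "u \<noteq> 0" "v \<noteq> 0" for x y u v
    \<comment> \<open>As \<open>q\<close> is nonzero, the shifted arguments stay nonzero, so the
      hypothesis kills all four terms.\<close>
    using that q(2) by (simp add: F2_from_F1)
  moreover have "F1 x y u v q = 0"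
    if F2: "\<forall>x y u v. x \<noteq> 0 \<longrightarrow> y \<noteq> 0 \<longrightarrow> u \<noteq> 0 \<longrightarrow> v \<noteq> 0 \<longrightarrow> F2 x y u v q = 0"
      and "x \<noteq> 0" "y \<noteq> 0" "u \<noteq> 0" "v \<noteq> 0" for x y u v
    using F1_from_F2[of y u x v] that by simp
  ultimately show ?thesis
    using F1_combination_eq_F2[OF q] F2_combination_eq_F1[OF q] by (intro conjI iffI allI impI) blast+
qed

end
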